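(* Let $u=[1][2][3][4]\in D_4$ and let $I=[e,u]$ be the closed interval between the identity $e$ and $u$ in the absolute order $\mathrm{Abs}(D_4)$. Then the Hasse diagram of the open interval $(e,u)$ is disconnected, and therefore $I$ is not Cohen-Macaulay over any field. Moreover, for every $n\ge4$ the poset $\mathrm{Abs}(D_n)$ is not Cohen-Macaulay over any field.
   Context: $B_n$ is the group of permutations $w$ of $\{\pm1,\dots,\pm n\}$ with $w(-i)=-w(i)$ for all $i$. For $a_1,\dots,a_k\in\{\pm1,\dots,\pm n\}$ with pairwise distinct absolute values, the paired $k$-cycle $(\!(a_1,\dots,a_k)\!)$ is the permutation with cycle form $(a_1\,a_2\cdots a_k)(-a_1\,-a_2\cdots -a_k)$, and the balanced $k$-cycle $[a_1,\dots,a_k]$ is the permutation with cycle form $(a_1\,a_2\cdots a_k\,-a_1\,-a_2\cdots -a_k)$. In particular $[i]$ exchanges $i$ and $-i$ and fixes all else. The Coxeter group $D_n$ is the subgroup of $B_n$ generated by the set $\mathcal T=\{(\!(i,j)\!),(\!(i,-j)\!):1\le i<j\le n\}$, which is the set of all reflections of $D_n$; equivalently, $D_n$ consists of the $w\in B_n$ with an even number of balanced cycles. Absolute order: for $w\in D_n$, the absolute length $\ell_{\mathcal T}(w)$ is the least $k$ such that $w$ is a product of $k$ elements of $\mathcal T$; $\mathrm{Abs}(D_n)$ is the partial order on $D_n$ given by $u\preceq v$ iff $\ell_{\mathcal T}(u)+\ell_{\mathcal T}(u^{-1}v)=\ell_{\mathcal T}(v)$. A finite poset $P$ is Cohen-Macaulay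 over a field $k$ if its order complex $\Delta(P)$ (the simplicial complex of chains of $P$) is, i.e. for every face $F$ of $\Delta(P)$, including $F=\varnothing$, the reduced simplicial homology $\tilde H_i(\mathrm{link}_{\Delta(P)}(F);k)$ vanishes for all $i<\dim \mathrm{link}_{\Delta(P)}(F)$. *)

theory Defs
  imports
    "HOL-Combinatorics.Cycles"
    "HOL-Algebra.Elementary_Groups"
    "Graph_Theory.Digraph_Component"
begin

section \<open>The Coxeter group of type D\<close>

definition signed_range :: "nat \<Rightarrow> int set" where
  "signed_range n = {i. 1 \<le> \<bar>i\<bar> \<and> \<bar>i\<bar> \<le> int n}"

text \<open>Elements of \<open>B_group n\<close> are total functions on \<^typ>\<open>int\<close>; by \<^const>\<open>permutes\<close> they are the
  identity outside \<^term>\<open>signed_range n\<close>.\<close>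

definition B_group :: "nat \<Rightarrow> (int \<Rightarrow> int) monoid" where
  "B_group n =
    \<lparr>carrier = {w. w permutes signed_range n \<and> (\<forall>i. w (- i) = - w i)}, monoid.mult = (\<circ>), one = id\<rparr>"

text \<open>Both notions below are meant for lists of integers with pairwise distinct absolute values.\<close>

definition paired_cycle :: "int list \<Rightarrow> int \<Rightarrow> int" where
  "paired_cycle as = cycle_of_list as \<circ> cycle_of_list (map uminus as)"

definition balanced_cycle :: "int list \<Rightarrow> int \<Rightarrow> int" where
  "balanced_cycle as = cycle_of_list (as @ map uminus as)"

definition D_reflections :: "nat \<Rightarrow> (int \<Rightarrow> int) set" where
  "D_reflections n =
    {paired_cycle [i, j] | i j. 1 \<le> i \<and> i < j \<and> j \<le> int n} \<union>
    {paired_cycle [i, - j] | i j. 1 \<le> i \<and> i < j \<and> j \<le> int n}"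

definition D_group :: "nat \<Rightarrow> (int \<Rightarrow> int) monoid" where
  "D_group n = subgroup_generated (B_group n) (D_reflections n)"

definition abs_length :: "nat \<Rightarrow> (int \<Rightarrow> int) \<Rightarrow> nat" where
  "abs_length n w =
    (LEAST k. \<exists>ts. length ts = k \<and> set ts \<subseteq> D_reflections n \<and> w = foldr (\<circ>) ts id)"

text \<open>The order of \<open>Abs(D\<^sub>n)\<close>; its underlying set is \<^term>\<open>carrier (D_group n)\<close>.\<close>

definition abs_le :: "nat \<Rightarrow> (int \<Rightarrow> int) \<Rightarrow> (int \<Rightarrow> int) \<Rightarrow> bool" where
  "abs_le n u v \<longleftrightarrow>
    abs_length n u + abs_length n (inv\<^bsub>D_group n\<^esub> u \<otimes>\<^bsub>D_group n\<^esub> v) = abs_length n v"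


section \<open>Posets: intervals and Hasse diagrams\<close>

text \<open>A poset is given by its underlying set \<open>P\<close> and an order predicate \<open>leq\<close>, which is only
  relevant on \<open>P\<close>.\<close>

definition closed_interval :: "'a set \<Rightarrow> ('a \<Rightarrow> 'a \<Rightarrow> bool) \<Rightarrow> 'a \<Rightarrow> 'a \<Rightarrow> 'a set" where
  "closed_interval P leq a b = {x \<in> P. leq a x \<and> leq x b}"

definition open_interval :: "'a set \<Rightarrow> ('a \<Rightarrow> 'a \<Rightarrow> bool) \<Rightarrow> 'a \<Rightarrow> 'a \<Rightarrow> 'a set" where
  "open_interval P leq a b = closed_interval P leq a b - {a, b}"

definition covered_by :: "'a set \<Rightarrow> ('a \<Rightarrow> 'a \<Rightarrow> bool) \<Rightarrow> 'a \<Rightarrow> 'a \<Rightarrow> bool" where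
  "covered_by P leq x y \<longleftrightarrow> x \<in> P \<and> y \<in> P \<and> leq x y \<and> x \<noteq> y \<and>
    \<not> (\<exists>z \<in> P. z \<noteq> x \<and> z \<noteq> y \<and> leq x z \<and> leq z y)"

definition hasse_diagram :: "'a set \<Rightarrow> ('a \<Rightarrow> 'a \<Rightarrow> bool) \<Rightarrow> 'a pair_pre_digraph" where
  "hasse_diagram P leq = \<lparr>pverts = P, parcs = {(x, y). covered_by P leq x y}\<rparr>"

text \<open>The library's \<^const>\<open>connected\<close> ignores the direction of arcs, but it is false for the graph
  without vertices, which should not count as disconnected.\<close>

definition disconnected :: "('a, 'b) pre_digraph \<Rightarrow> bool" where
  "disconnected G \<longleftrightarrow> verts G \<noteq> {} \<and> \<not> connected G"


section \<open>Reduced simplicial homology\<close>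

text \<open>A finite simplicial complex is a set \<open>K\<close> of finite sets, closed under subsets. The empty face
  belongs to \<open>K\<close> and spans the chains of degree \<open>-1\<close>, so that the homology below is the reduced one.

  An oriented \<open>i\<close>-simplex is given by an ordering of its vertices, a list of length \<open>i + 1\<close>. A chain
  assigns a coefficient to each such list and changes sign when two consecutive vertices are
  exchanged, hence by the sign of the permutation under any reordering.\<close>

definition chains :: "'a set set \<Rightarrow> int \<Rightarrow> ('a list \<Rightarrow> 'k::field) set" where
  "chains K i = {c.
    (\<forall>xs. c xs \<noteq> 0 \<longrightarrow> distinct xs \<and> set xs \<in> K \<and> int (length xs) = i + 1) \<and>
    (\<forall>xs x y ys. c (xs @ x # y # ys) = - c (xs @ y # x # ys))}"

text \<open>The oriented simplex \<open>xs\<close> occurs in the boundary of \<open>v # xs\<close> with sign \<open>+1\<close>; by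
  antisymmetry, each oriented simplex having \<open>xs\<close> as a facet may be written in this form.\<close>

definition boundary :: "'a set set \<Rightarrow> ('a list \<Rightarrow> 'k::field) \<Rightarrow> 'a list \<Rightarrow> 'k" where
  "boundary K c = (\<lambda>xs. \<Sum>v \<in> \<Union>K. c (v # xs))"

definition cycles :: "'a set set \<Rightarrow> int \<Rightarrow> ('a list \<Rightarrow> 'k::field) set" where
  "cycles K i = {c \<in> chains K i. boundary K c = (\<lambda>_. 0)}"

definition boundaries :: "'a set set \<Rightarrow> int \<Rightarrow> ('a list \<Rightarrow> 'k::field) set" where
  "boundaries K i = boundary K ` chains K (i + 1)"

definition cycle_group :: "'a set set \<Rightarrow> int \<Rightarrow> ('a list \<Rightarrow> 'k::field) monoid" where
  "cycle_group K i =
    \<lparr>carrier = cycles K i, monoid.mult = (\<lambda>c d xs. c xs + d xs), one = (\<lambda>_. 0)\<rparr>"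

definition reduced_homology :: "'a set set \<Rightarrow> int \<Rightarrow> ('a list \<Rightarrow> 'k::field) set monoid" where
  "reduced_homology K i = cycle_group K i Mod boundaries K i"


section \<open>Cohen-Macaulay posets\<close>

definition order_complex :: "'a set \<Rightarrow> ('a \<Rightarrow> 'a \<Rightarrow> bool) \<Rightarrow> 'a set set" where
  "order_complex P leq = {C. C \<subseteq> P \<and> finite C \<and> Complete_Partial_Order.chain leq C}"

definition link :: "'a set set \<Rightarrow> 'a set \<Rightarrow> 'a set set" where
  "link K F = {G \<in> K. G \<inter> F = {} \<and> G \<union> F \<in> K}"

definition dimension :: "'a set set \<Rightarrow> int" where
  "dimension K = int (Max (card ` K)) - 1"

definition cohen_macaulay_complex :: "'k::field itself \<Rightarrow> 'a set set \<Rightarrow> bool" where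
  "cohen_macaulay_complex _ K \<longleftrightarrow>
    (\<forall>F \<in> K. \<forall>i < dimension (link K F).
      let H = (reduced_homology (link K F) i :: ('a list \<Rightarrow> 'k) set monoid)
      in carrier H = {\<one>\<^bsub>H\<^esub>})"

definition cohen_macaulay :: "'k::field itself \<Rightarrow> 'a set \<Rightarrow> ('a \<Rightarrow> 'a \<Rightarrow> bool) \<Rightarrow> bool" where
  "cohen_macaulay k P leq \<longleftrightarrow> cohen_macaulay_complex k (order_complex P leq)"

end

theory Submission
  imports Complex_Main Defs
begin

text \<open>In \<open>D\<^sub>4\<close> the element \<open>u\<close> acts as \<open>-1\<close> on a four-dimensional space, so four reflections with
  product \<open>u\<close> have pairwise orthogonal roots supported on the coordinates \<open>1, \<dots>, 4\<close>. Orthogonal roots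
  of \<open>D\<^sub>4\<close> induce the same partition of \<open>{1, 2, 3, 4}\<close> into two pairs. Hence any two comparable
  elements strictly between \<open>e\<close> and \<open>u\<close> preserve a common such partition, and only \<open>e\<close> and \<open>u\<close>
  preserve more than one: the open interval splits according to the three partitions. In \<open>D\<^sub>n\<close>, this
  open interval is the vertex set of the link of \<open>e\<close> together with a maximal chain above \<open>u\<close>.\<close>

section \<open>A disconnected complex has nonzero reduced homology in degree zero\<close>

text \<open>Off the diagonal the terms cancel in pairs. The vanishing of the diagonal is a separate
  hypothesis because antisymmetry does not yield it in characteristic two.\<close>

lemma sum_antisymmetric_eq_0:
  fixes f :: "'a \<Rightarrow> 'a \<Rightarrow> 'k::field"
  assumes "finite A" and "\<And>x. f x x = 0" and "\<And>x y. f x y = - f y x"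
  shows "(\<Sum>x\<in>A. \<Sum>y\<in>A. f x y) = 0"
  using assms(1)
proof (induction A rule: finite_induct)
  case (insert a A)
  have "(\<Sum>y\<in>A. f a y) = - (\<Sum>x\<in>A. f x a)"
    by (simp add: assms(3)[of a] sum_negf)
  then show ?case
    using insert by (simp add: sum.distrib assms(2))
qed simp

text \<open>The cycle \<open>[a] - [b]\<close> is not a boundary. Adding up the coefficients at the
  vertices in \<open>A\<close> kills every boundary, since each edge has both endpoints in
  \<open>A\<close> or neither, but gives 1 on this cycle.\<close>

lemma reduced_homology_0_nontrivial:
  fixes K :: "'a set set" and H :: "('a list \<Rightarrow> 'k::field) set monoid"
  assumes H: "H = reduced_homology K 0" and fin: "finite (\<Union>K)"
    and a: "{a} \<in> K" "a \<in> A" and b: "{b} \<in> K" "b \<notin> A"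
    and edge: "\<And>v w. {v, w} \<in> K \<Longrightarrow> v \<in> A \<longleftrightarrow> w \<in> A"
  shows "carrier H \<noteq> {\<one>\<^bsub>H\<^esub>}"
proof
  assume triv: "carrier H = {\<one>\<^bsub>H\<^esub>}"
  define z :: "'a list \<Rightarrow> 'k" where "z = (\<lambda>xs. if xs = [a] then 1 else if xs = [b] then -1 else 0)"
  have ab: "a \<noteq> b" "a \<in> \<Union>K" "b \<in> \<Union>K" using a b by auto
  have "boundary K z xs = 0" for xs
  proof (cases xs)
    case Nil
    have "boundary K z [] = (\<Sum>v\<in>\<Union>K. (if v = a then 1 else 0) + (if v = b then - 1 else 0))"
      unfolding boundary_def z_def using ab(1) by (intro sum.cong) auto
    also have "\<dots> = 0" using ab fin by (simp add: sum.distrib)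
    finally show ?thesis using Nil by simp
  next
    case Cons
    then show ?thesis by (simp add: boundary_def z_def)
  qed
  moreover have "z \<in> chains K 0"
    using a b by (auto simp: chains_def z_def split: if_splits)
  ultimately have z: "z \<in> cycles K 0" by (auto simp: cycles_def)
  \<comment> \<open>As the zero chain is a boundary, \<open>z\<close> lies in its own coset; a
    trivial quotient therefore makes \<open>z\<close> itself a boundary.\<close>
  have zero: "(\<lambda>_. 0) \<in> boundaries K 0"
    unfolding boundaries_def
    by (rule image_eqI[of _ _ "\<lambda>_. 0"]) (auto simp: boundary_def chains_def)
  have "r_coset (cycle_group K 0) (boundaries K 0) z \<in> carrier H"
    using z by (simp add: H reduced_homology_def carrier_FactGroup cycle_group_def)
  then have "r_coset (cycle_group K 0) (boundaries K 0) z = boundaries K 0"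
    unfolding triv by (simp add: H reduced_homology_def)
  moreover have "z \<in> r_coset (cycle_group K 0) (boundaries K 0) z"
    using zero by (auto simp: r_coset_def cycle_group_def intro: bexI[of _ "\<lambda>_. 0"])
  ultimately obtain c where c: "c \<in> chains K 1" "z = boundary K c"
    by (auto simp: boundaries_def)
  define B where "B = A \<inter> \<Union>K"
  have B: "finite B" "B \<subseteq> \<Union>K" using fin by (auto simp: B_def)
  have supp: "distinct xs \<and> set xs \<in> K" if "c xs \<noteq> 0" for xs
    using c(1) that by (auto simp: chains_def)
  have anti: "c [v, w] = - c [w, v]" for v w
    using c(1) unfolding chains_def mem_Collect_eq by (metis append_Nil)
  have "z [w] = (\<Sum>v\<in>B. c [v, w])" if "w \<in> B" for w
  proof -
    \<comment> \<open>No edge leaves \<open>B\<close>, so only its own vertices contribute to the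
      boundary at \<open>w\<close>.\<close>
    have "c [v, w] = 0" if "v \<in> \<Union>K - B" for v
      using supp[of "[v, w]"] edge[of v w] that \<open>w \<in> B\<close> by (auto simp: B_def)
    then have "(\<Sum>v\<in>\<Union>K. c [v, w]) = (\<Sum>v\<in>B. c [v, w])"
      using fin B by (intro sum.mono_neutral_right) auto
    then show ?thesis by (simp add: c(2) boundary_def)
  qed
  then have "(\<Sum>w\<in>B. z [w]) = (\<Sum>w\<in>B. \<Sum>v\<in>B. c [v, w])" by simp
  also have "\<dots> = 0"
  proof (rule sum_antisymmetric_eq_0[OF B(1)])
    show "c [v, v] = 0" for v using supp[of "[v, v]"] by auto
  qed (rule anti)
  finally have "(\<Sum>w\<in>B. z [w]) = 0" .
  moreover have "(\<Sum>w\<in>B. z [w]) = (\<Sum>w\<in>B. if w = a then 1 else 0)"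
    using b by (intro sum.cong) (auto simp: z_def B_def)
  ultimately show False using B a ab by (auto simp: B_def)
qed

text \<open>The edge \<open>{c, d}\<close> gives the link dimension at least one, so degree zero is
  among the degrees in which homology would have to vanish.\<close>

lemma not_cohen_macaulay_complex:
  fixes k :: "'k::field itself" and K :: "'a set set"
  assumes F: "F \<in> K" and fin: "finite (\<Union>K)"
    and a: "{a} \<in> link K F" "a \<in> A" and b: "{b} \<in> link K F" "b \<notin> A"
    and "{c, d} \<in> link K F" "c \<noteq> d"
    and edge: "\<And>v w. {v, w} \<in> link K F \<Longrightarrow> v \<in> A \<longleftrightarrow> w \<in> A"
  shows "\<not> cohen_macaulay_complex k K"
proof
  assume cm: "cohen_macaulay_complex k K"
  have fin': "finite (\<Union>(link K F))"
    by (rule finite_subset[OF _ fin]) (auto simp: link_def)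
  have "card {c, d} \<le> Max (card ` link K F)"
    using fin' assms(7) by (intro Max_ge finite_imageI imageI) (auto intro: finite_UnionD)
  then have "0 < dimension (link K F)"
    using \<open>c \<noteq> d\<close> by (simp add: dimension_def)
  with cm F have "let H = reduced_homology (link K F) 0 :: ('a list \<Rightarrow> 'k) set monoid
      in carrier H = {\<one>\<^bsub>H\<^esub>}"
    unfolding cohen_macaulay_complex_def by blast
  then show False
    using reduced_homology_0_nontrivial[OF refl fin' a b edge, where 'k = 'k] by (auto simp: Let_def)
qed

text \<open>Covering elements are comparable, so an undirected path that starts in \<open>A\<close>
  never leaves it.\<close>

lemma hasse_diagram_disconnected:
  assumes a: "a \<in> P" "a \<in> A" and b: "b \<in> P" "b \<notin> A"
    and comparable: "\<And>x y. x \<in> P \<Longrightarrow> y \<in> P \<Longrightarrow> leq x y \<Longrightarrow> x \<in> A \<longleftrightarrow> y \<in> A"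
  shows "disconnected (hasse_diagram P leq)"
proof -
  let ?G = "with_proj (hasse_diagram P leq)"
  have arc: "x \<in> A \<longleftrightarrow> y \<in> A" if "(x, y) \<in> parcs (mk_symmetric ?G)" for x y
    using that comparable
    by (fastforce simp: parcs_mk_symmetric hasse_diagram_def covered_by_def)
  have "y \<in> A" if "(a, y) \<in> rtrancl_on P (parcs (mk_symmetric ?G))" for y
    using that
  proof (induction rule: rtrancl_on_induct)
    case (step y z)
    then show ?case using arc by blast
  qed (use a in simp)
  then have "(a, b) \<notin> rtrancl_on P (parcs (mk_symmetric ?G))"
    using b by blast
  then show ?thesis
    using a b by (auto simp: disconnected_def connected_def strongly_connected_def
        reachable_def hasse_diagram_def)
qed

section \<open>Homogeneous linear systems\<close>

text \<open>Gaussian elimination, one equation per induction step: an equation whose coefficients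
  vanish on \<open>J\<close> is dropped, any other one eliminates an unknown.\<close>

lemma ex_nontrivial_solution:
  fixes cs :: "('a \<Rightarrow> 'k::field) list"
  assumes "finite J" and "length cs < card J"
  shows "\<exists>x. (\<exists>j\<in>J. x j \<noteq> 0) \<and> (\<forall>c\<in>set cs. (\<Sum>j\<in>J. c j * x j) = 0)"
  using assms
proof (induction "length cs" arbitrary: cs J)
  case 0
  then show ?case by (intro exI[of _ "\<lambda>_. 1"]) (auto simp: card_gt_0_iff)
next
  case (Suc k)
  then obtain c ds where cs: "cs = c # ds" by (cases cs) auto
  show ?case
  proof (cases "\<forall>j\<in>J. c j = 0")
    case True
    with Suc cs show ?thesis by fastforce
  next
    case False
    then obtain p where p: "p \<in> J" "c p \<noteq> 0" by blast
    define J' where "J' = J - {p}"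
    have J: "J = insert p J'" "p \<notin> J'" "finite J'" using p Suc.prems by (auto simp: J'_def)
    obtain x where x: "\<exists>j\<in>J'. x j \<noteq> 0"
      and sol: "\<And>d. d \<in> set ds \<Longrightarrow> (\<Sum>j\<in>J'. (d j - d p / c p * c j) * x j) = 0"
      using Suc.hyps(1)[of "map (\<lambda>d j. d j - d p / c p * c j) ds" J'] Suc.hyps(2) Suc.prems cs J
      by auto
    \<comment> \<open>The equation \<open>c\<close> forces the value at the pivot \<open>p\<close>;
      with this value each reduced equation turns back into the original equation
      \<open>d\<close>.\<close>
    define y where "y = x(p := - (\<Sum>j\<in>J'. c j * x j) / c p)"
    have y: "(\<Sum>j\<in>J. d j * y j) = d p * y p + (\<Sum>j\<in>J'. d j * x j)" for d
    proof -
      have "(\<Sum>j\<in>J'. d j * y j) = (\<Sum>j\<in>J'. d j * x j)"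
        using J by (intro sum.cong) (auto simp: y_def)
      then show ?thesis using J by simp
    qed
    have "(\<Sum>j\<in>J. d j * y j) = 0" if "d \<in> set ds" for d
      using sol[OF that] p(2)
      by (simp add: y) (simp add: y_def algebra_simps sum_subtractf sum_distrib_left sum_divide_distrib)
    moreover have "(\<Sum>j\<in>J. c j * y j) = 0"
      unfolding y using p(2) by (simp add: y_def)
    moreover have "\<exists>j\<in>J. y j \<noteq> 0"
      using x J by (auto simp: y_def)
    ultimately show ?thesis using cs by auto
  qed
qed

section \<open>Reflections and the absolute order\<close>

lemma group_B_group: "Group.group (B_group n)"
proof (rule groupI)
  fix w assume w: "w \<in> carrier (B_group n)"
  then have bij: "bij w" by (auto simp: B_group_def intro: permutes_bij)
  have "inv_into UNIV w (- i) = - inv_into UNIV w i" for i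
  proof (rule inv_f_eq)
    show "inj w" using bij by (rule bij_is_inj)
    show "w (- inv_into UNIV w i) = - i"
      using w bij by (simp add: B_group_def bij_is_surj surj_f_inv_f)
  qed
  then have "inv_into UNIV w \<in> carrier (B_group n)"
    using w by (auto simp: B_group_def permutes_inv)
  moreover have "inv_into UNIV w \<otimes>\<^bsub>B_group n\<^esub> w = \<one>\<^bsub>B_group n\<^esub>"
    using bij by (simp add: B_group_def bij_is_inj)
  ultimately show "\<exists>v\<in>carrier (B_group n). v \<otimes>\<^bsub>B_group n\<^esub> w = \<one>\<^bsub>B_group n\<^esub>" by blast
qed (auto simp: B_group_def permutes_compose permutes_id fun.map_comp)

lemma paired_cycle_apply:
  assumes "a \<noteq> 0" "b \<noteq> 0" "\<bar>a\<bar> \<noteq> \<bar>b\<bar>"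
  shows "paired_cycle [a, b] i =
    (if i = a then b else if i = b then a else if i = - a then - b else if i = - b then - a else i)"
  using assms by (auto simp: paired_cycle_def transpose_def)

text \<open>Entries of either sign merge the two families of \<open>D_reflections\<close> into a
  single form.\<close>

lemma D_reflectionsE:
  assumes "t \<in> D_reflections n"
  obtains a b where "a \<noteq> 0" "b \<noteq> 0" "\<bar>a\<bar> \<noteq> \<bar>b\<bar>" "\<bar>a\<bar> \<le> int n" "\<bar>b\<bar> \<le> int n"
    "t = paired_cycle [a, b]"
proof -
  obtain i j where "1 \<le> i" "i < j" "j \<le> int n" "t = paired_cycle [i, j] \<or> t = paired_cycle [i, - j]"
    using assms by (auto simp: D_reflections_def)
  then show ?thesis
    by (elim disjE) (rule that[of i j] that[of i "- j"]; simp)+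
qed

lemma reflection_involution: "t \<circ> t = id" if "t \<in> D_reflections n"
  by (rule D_reflectionsE[OF that]) (auto simp: paired_cycle_apply fun_eq_iff)

lemma reflection_in_B_group:
  assumes "t \<in> D_reflections n"
  shows "t \<in> carrier (B_group n)"
proof -
  obtain a b where ab: "a \<noteq> 0" "b \<noteq> 0" "\<bar>a\<bar> \<noteq> \<bar>b\<bar>" "\<bar>a\<bar> \<le> int n" "\<bar>b\<bar> \<le> int n"
    "t = paired_cycle [a, b]"
    using assms by (rule D_reflectionsE)
  have "bij t"
    using reflection_involution[OF assms] by (metis o_bij)
  moreover have "t i = i" if "i \<notin> signed_range n" for i
    using ab that by (auto simp: signed_range_def paired_cycle_apply)
  ultimately have "t permutes signed_range n"
    by (auto simp: permutes_def bij_iff)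
  moreover have "t (- i) = - t i" for i
    using ab by (auto simp: paired_cycle_apply)
  ultimately show ?thesis by (simp add: B_group_def)
qed

section \<open>Words in the reflections\<close>

definition refl_prod :: "(int \<Rightarrow> int) list \<Rightarrow> int \<Rightarrow> int" where
  "refl_prod ts = foldr (\<circ>) ts id"

lemma refl_prod_simps [simp]: "refl_prod [] = id" "refl_prod (t # ts) = t \<circ> refl_prod ts"
  by (simp_all add: refl_prod_def)

lemma refl_prod_append: "refl_prod (ss @ ts) = refl_prod ss \<circ> refl_prod ts"
  by (induction ss) (auto simp: o_assoc)

text \<open>Reflections are involutions, so the two adjacent copies of \<open>t\<close> in the
  middle cancel.\<close>

lemma refl_prod_rev: "refl_prod (rev ts) \<circ> refl_prod ts = id" if "set ts \<subseteq> D_reflections n"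
  using that
proof (induction ts)
  case (Cons t ts)
  have "refl_prod (rev (t # ts)) \<circ> refl_prod (t # ts) = refl_prod (rev ts) \<circ> (t \<circ> t) \<circ> refl_prod ts"
    by (simp only: rev.simps refl_prod_append refl_prod_simps comp_id o_assoc)
  also have "\<dots> = refl_prod (rev ts) \<circ> refl_prod ts"
  proof -
    have "t \<circ> t = id" using Cons.prems by (intro reflection_involution) auto
    then show ?thesis by (simp only: comp_id)
  qed
  also have "\<dots> = id" using Cons.prems by (intro Cons.IH) auto
  finally show ?case .
qed simp

lemma D_group_simps [simp]: "x \<otimes>\<^bsub>D_group n\<^esub> y = x \<circ> y" "\<one>\<^bsub>D_group n\<^esub> = id"
  by (simp_all add: D_group_def B_group_def)

lemma group_D_group: "Group.group (D_group n)"
  unfolding D_group_def by (rule group.group_subgroup_generated[OF group_B_group])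

text \<open>Each generator is its own inverse, so words in the generators already exhaust the
  generated subgroup.\<close>

lemma carrier_D_group: "carrier (D_group n) = refl_prod ` {ts. set ts \<subseteq> D_reflections n}"
proof (intro equalityI subsetI)
  fix w assume "w \<in> carrier (D_group n)"
  \<comment> \<open>\<open>subgroup_generated\<close> intersects the generators with the carrier;
    this changes nothing, since all reflections lie in \<open>B_group n\<close>.\<close>
  then have "w \<in> generate (B_group n) (D_reflections n)"
    using reflection_in_B_group
    by (simp add: D_group_def carrier_subgroup_generated Int_absorb1 subset_iff)
  then show "w \<in> refl_prod ` {ts. set ts \<subseteq> D_reflections n}"
  proof induction
    case one
    then show ?case by (intro image_eqI[of _ _ "[]"]) (auto simp: B_group_def)
  next
    case (incl h)
    then show ?case by (intro image_eqI[of _ _ "[h]"]) auto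
  next
    case (inv h)
    have "inv\<^bsub>B_group n\<^esub> h = h"
      using inv reflection_involution[OF inv] reflection_in_B_group[OF inv]
      by (intro group.inv_equality[OF group_B_group]) (auto simp: B_group_def)
    then show ?case using inv by (intro image_eqI[of _ _ "[h]"]) auto
  next
    case (eng g h)
    then obtain ss ts where "set ss \<subseteq> D_reflections n" "set ts \<subseteq> D_reflections n"
      "g = refl_prod ss" "h = refl_prod ts" by auto
    then show ?case
      by (intro image_eqI[of _ _ "ss @ ts"]) (auto simp: refl_prod_append B_group_def)
  qed
next
  fix w assume "w \<in> refl_prod ` {ts. set ts \<subseteq> D_reflections n}"
  then obtain ts where "set ts \<subseteq> D_reflections n" "w = refl_prod ts" by blast
  then show "w \<in> carrier (D_group n)"
  proof (induction ts arbitrary: w)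
    case Nil
    then show ?case
      using monoid.one_closed[OF group.is_monoid[OF group_D_group, of n]] by (simp only: D_group_simps refl_prod_simps)
  next
    case (Cons t ts)
    have "t \<in> carrier (D_group n)"
      using Cons.prems reflection_in_B_group[of t n]
      by (auto simp: D_group_def carrier_subgroup_generated intro: generate.incl)
    moreover have "refl_prod ts \<in> carrier (D_group n)" using Cons by simp
    ultimately show ?case
      using Cons.prems monoid.m_closed[OF group.is_monoid[OF group_D_group, of n], of t "refl_prod ts"]
      by (simp only: D_group_simps refl_prod_simps)
  qed
qed

lemma refl_prod_in_D_group: "set ts \<subseteq> D_reflections n \<Longrightarrow> refl_prod ts \<in> carrier (D_group n)"
  by (auto simp: carrier_D_group)

lemma D_group_comp_closed:
  "x \<in> carrier (D_group n) \<Longrightarrow> y \<in> carrier (D_group n) \<Longrightarrow> x \<circ> y \<in> carrier (D_group n)"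
  using monoid.m_closed[OF group.is_monoid[OF group_D_group, of n], of x y] by simp

lemma D_group_subset_B_group: "carrier (D_group n) \<subseteq> carrier (B_group n)"
  unfolding D_group_def by (rule group.carrier_subgroup_generated_subset[OF group_B_group])

lemma D_group_odd: "w \<in> carrier (D_group n) \<Longrightarrow> w (- i) = - w i"
  using D_group_subset_B_group by (auto simp: B_group_def)

lemma finite_D_group: "finite (carrier (D_group n))"
proof (rule finite_subset[OF D_group_subset_B_group], rule finite_subset)
  show "finite {w. w permutes signed_range n}"
    by (rule finite_permutations, rule finite_subset[of _ "{- int n..int n}"])
      (auto simp: signed_range_def)
qed (auto simp: B_group_def)

lemma inv_refl_prod:
  assumes "set ts \<subseteq> D_reflections n"
  shows "inv\<^bsub>D_group n\<^esub> (refl_prod ts) = refl_prod (rev ts)"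
  using assms refl_prod_rev[OF assms]
  by (intro group.inv_equality[OF group_D_group]) (auto intro!: refl_prod_in_D_group)

section \<open>Shortest words and the absolute order\<close>

lemma abs_length_le: "set ts \<subseteq> D_reflections n \<Longrightarrow> abs_length n (refl_prod ts) \<le> length ts"
  unfolding abs_length_def refl_prod_def by (rule Least_le) blast

lemma reduced_wordE:
  assumes "w \<in> carrier (D_group n)"
  obtains ts where "set ts \<subseteq> D_reflections n" "w = refl_prod ts" "length ts = abs_length n w"
proof -
  have "\<exists>k ts. length ts = k \<and> set ts \<subseteq> D_reflections n \<and> w = refl_prod ts"
    using assms by (auto simp: carrier_D_group)
  from LeastI_ex[OF this] show ?thesis using that by (auto simp: abs_length_def refl_prod_def)
qed

lemma abs_length_comp_le:
  assumes "x \<in> carrier (D_group n)" "y \<in> carrier (D_group n)"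
  shows "abs_length n (x \<circ> y) \<le> abs_length n x + abs_length n y"
proof -
  obtain ss ts where "set ss \<subseteq> D_reflections n" "x = refl_prod ss" "length ss = abs_length n x"
    "set ts \<subseteq> D_reflections n" "y = refl_prod ts" "length ts = abs_length n y"
    using reduced_wordE assms by metis
  then show ?thesis using abs_length_le[of "ss @ ts" n] by (simp add: refl_prod_append)
qed

text \<open>The lengths of the two products sum to at least the length of the whole, by
  subadditivity, and neither exceeds the length of its word. Hence equality holds
  throughout.\<close>

lemma abs_length_prefix:
  assumes "set (ss @ ts) \<subseteq> D_reflections n" "abs_length n (refl_prod (ss @ ts)) = length (ss @ ts)"
  shows "abs_length n (refl_prod ss) = length ss" "abs_length n (refl_prod ts) = length ts"
  using abs_length_comp_le[of "refl_prod ss" n "refl_prod ts"] abs_length_le[of ss n]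
    abs_length_le[of ts n] assms
  by (auto simp: refl_prod_append refl_prod_in_D_group)

text \<open>The quotient of the two products is the product of \<open>ts\<close>, whose word is
  again shortest.\<close>

lemma abs_le_refl_prod:
  assumes "set (ss @ ts) \<subseteq> D_reflections n" "abs_length n (refl_prod (ss @ ts)) = length (ss @ ts)"
  shows "abs_le n (refl_prod ss) (refl_prod (ss @ ts))"
proof -
  have "refl_prod (rev ss) \<circ> (refl_prod ss \<circ> refl_prod ts) = refl_prod ts"
    using refl_prod_rev[of ss n] assms(1) unfolding o_assoc by (metis Un_subset_iff id_comp set_append)
  then show ?thesis
    using assms abs_length_prefix[OF assms] by (simp add: abs_le_def inv_refl_prod refl_prod_append)
qed

text \<open>A shortest word for the quotient of \<open>y\<close> by \<open>x\<close> is appended to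
  \<open>ss\<close>; the definition of the order says that the lengths add up. With the converse
  \<open>abs_le_refl_prod\<close>, going up in the order amounts to prolonging a shortest
  word.\<close>

lemma abs_leE:
  assumes "abs_le n x y" "x \<in> carrier (D_group n)" "y \<in> carrier (D_group n)"
    and "set ss \<subseteq> D_reflections n" "x = refl_prod ss" "length ss = abs_length n x"
  obtains ts where "set ts \<subseteq> D_reflections n" "y = refl_prod (ss @ ts)"
    "length (ss @ ts) = abs_length n y"
proof -
  have "inv\<^bsub>D_group n\<^esub> x \<in> carrier (D_group n)"
    using assms(2) by (rule group.inv_closed[OF group_D_group])
  then have "inv\<^bsub>D_group n\<^esub> x \<circ> y \<in> carrier (D_group n)"
    using assms(3) by (rule D_group_comp_closed)
  then obtain ts where ts: "set ts \<subseteq> D_reflections n" "inv\<^bsub>D_group n\<^esub> x \<circ> y = refl_prod ts"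
    "length ts = abs_length n (inv\<^bsub>D_group n\<^esub> x \<circ> y)"
    by (rule reduced_wordE)
  have "x \<circ> inv\<^bsub>D_group n\<^esub> x = id"
    using group.r_inv[OF group_D_group assms(2)] by simp
  then have "y = x \<circ> (inv\<^bsub>D_group n\<^esub> x \<circ> y)" by (simp only: o_assoc id_comp)
  then have "y = refl_prod (ss @ ts)" using ts assms(5) by (simp add: refl_prod_append)
  then show ?thesis using that ts assms(1,6) by (simp add: abs_le_def)
qed

lemma abs_le_trans:
  assumes "abs_le n x y" "abs_le n y z"
    and "x \<in> carrier (D_group n)" "y \<in> carrier (D_group n)" "z \<in> carrier (D_group n)"
  shows "abs_le n x z"
proof -
  obtain ss where ss: "set ss \<subseteq> D_reflections n" "x = refl_prod ss" "length ss = abs_length n x"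
    using assms(3) by (rule reduced_wordE)
  obtain ts where ts: "set ts \<subseteq> D_reflections n" "y = refl_prod (ss @ ts)"
    "length (ss @ ts) = abs_length n y"
    using abs_leE[OF assms(1,3,4) ss] .
  then obtain rs where "set rs \<subseteq> D_reflections n" "z = refl_prod ((ss @ ts) @ rs)"
    "length ((ss @ ts) @ rs) = abs_length n z"
    using abs_leE[OF assms(2,4,5), of "ss @ ts"] ss by auto
  then show ?thesis using abs_le_refl_prod[of ss "ts @ rs" n] ss ts by simp
qed

lemma abs_le_antisym:
  assumes "abs_le n x y" "abs_le n y x" "x \<in> carrier (D_group n)" "y \<in> carrier (D_group n)"
  shows "x = y"
proof -
  obtain ss where ss: "set ss \<subseteq> D_reflections n" "x = refl_prod ss" "length ss = abs_length n x"
    using assms(3) by (rule reduced_wordE)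
  obtain ts where ts: "set ts \<subseteq> D_reflections n" "y = refl_prod (ss @ ts)"
    "length (ss @ ts) = abs_length n y"
    using abs_leE[OF assms(1,3,4) ss] .
  \<comment> \<open>The second relation bounds the length of \<open>y\<close> by that of
    \<open>x\<close>, so the appended word is empty.\<close>
  have "abs_length n y \<le> abs_length n x" using assms(2) by (simp add: abs_le_def)
  then have "length ts = 0" using ss(3) ts(3) unfolding length_append by linarith
  then show ?thesis using ss(2) ts(2) by simp
qed

lemma id_in_D_group: "id \<in> carrier (D_group n)"
  using refl_prod_in_D_group[of "[]"] by simp

lemma abs_length_id: "abs_length n id = 0"
  using abs_length_le[of "[]" n] by simp

lemma abs_le_id: "w \<in> carrier (D_group n) \<Longrightarrow> abs_le n id w"
  by (erule reduced_wordE) (use abs_le_refl_prod[of "[]"] in auto)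

lemma abs_le_refl: "w \<in> carrier (D_group n) \<Longrightarrow> abs_le n w w"
  by (erule reduced_wordE) (use abs_le_refl_prod[of _ "[]"] in auto)

section \<open>Factorizations of the negation on four coordinates\<close>

text \<open>This is the element \<open>u\<close>, written without n so that the same function serves
  in every \<open>D_group n\<close> with n at least 4.\<close>

definition negate4 :: "int \<Rightarrow> int" where
  "negate4 i = (if \<bar>i\<bar> \<le> 4 then - i else i)"

lemma negate4_eq_balanced_cycles:
  "balanced_cycle [1] \<circ> balanced_cycle [2] \<circ> balanced_cycle [3] \<circ> balanced_cycle [4] = negate4"
proof
  fix i :: int
  have "\<bar>i\<bar> \<le> 4 \<longleftrightarrow> i \<in> {-4, -3, -2, -1, 0, 1, 2, 3, 4}" by auto
  then show "(balanced_cycle [1] \<circ> balanced_cycle [2] \<circ> balanced_cycle [3] \<circ> balanced_cycle [4]) i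
      = negate4 i"
    by (auto simp: balanced_cycle_def negate4_def transpose_def)
qed

text \<open>Signed permutations act on vectors from the right, a vector being an odd function on the
  signed indices; the vectors fixed by a reflection form its hyperplane. Three hyperplanes have
  a common nonzero vector in the \<open>-1\<close>-eigenspace of \<^const>\<open>negate4\<close>.\<close>

lemma ex_fixed_vector:
  assumes "set ts \<subseteq> D_reflections n" "length ts \<le> 3"
  obtains x :: "int \<Rightarrow> rat" where "\<And>i. x (- i) = - x i" "\<And>t. t \<in> set ts \<Longrightarrow> x \<circ> t = x"
    "\<And>i. \<bar>i\<bar> > 4 \<Longrightarrow> x i = 0" "\<exists>i. x i \<noteq> 0"
proof -
  \<comment> \<open>\<open>e j\<close> is the j-th unit vector, extended to an odd function.\<close>
  define e :: "int \<Rightarrow> int \<Rightarrow> rat" where "e j i = of_bool (i = j) - of_bool (i = - j)" for j i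
  have "\<forall>t\<in>D_reflections n. \<exists>a b. a \<noteq> 0 \<and> b \<noteq> 0 \<and> \<bar>a\<bar> \<noteq> \<bar>b\<bar> \<and> t = paired_cycle [a, b]"
    by (meson D_reflectionsE)
  then obtain a b where ab: "\<And>t. t \<in> D_reflections n \<Longrightarrow>
      a t \<noteq> 0 \<and> b t \<noteq> 0 \<and> \<bar>a t\<bar> \<noteq> \<bar>b t\<bar> \<and> t = paired_cycle [a t, b t]"
    by metis
  \<comment> \<open>The reflection \<open>t\<close> fixes an odd vector that takes equal values at
    \<open>a t\<close> and \<open>b t\<close>. This gives at most three equations in the four
    coordinates \<open>y j\<close>.\<close>
  obtain y where y: "\<exists>j\<in>{1..4::int}. y j \<noteq> 0"
    "\<And>t. t \<in> set ts \<Longrightarrow> (\<Sum>j\<in>{1..4}. (e j (a t) - e j (b t)) * y j) = 0"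
    using ex_nontrivial_solution[of "{1..4::int}" "map (\<lambda>t j. e j (a t) - e j (b t)) ts"] assms(2)
    by auto
  define x where "x i = (\<Sum>j\<in>{1..4}. e j i * y j)" for i
  have odd: "x (- i) = - x i" for i
    unfolding x_def by (auto simp: e_def sum_negf[symmetric] intro!: sum.cong)
  show ?thesis
  proof
    fix t assume t: "t \<in> set ts"
    then have "x (a t) = x (b t)"
      using y(2)[of t] by (simp add: x_def algebra_simps sum_subtractf)
    moreover have "a t \<noteq> 0 \<and> b t \<noteq> 0 \<and> \<bar>a t\<bar> \<noteq> \<bar>b t\<bar> \<and> t = paired_cycle [a t, b t]"
      using ab assms(1) t by blast
    ultimately show "x \<circ> t = x"
      using paired_cycle_apply[of "a t" "b t"] odd by (auto simp: fun_eq_iff)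
  next
    show "x i = 0" if "\<bar>i\<bar> > 4" for i
      unfolding x_def using that by (intro sum.neutral) (auto simp: e_def)
  next
    obtain j where j: "j \<in> {1..4::int}" "y j \<noteq> 0" using y by blast
    have "x j = (\<Sum>k\<in>{1..4}. if k = j then y j else 0)"
      unfolding x_def using j(1) by (intro sum.cong) (auto simp: e_def)
    then have "x j \<noteq> 0" using j by simp
    then show "\<exists>i. x i \<noteq> 0" ..
  qed (rule odd)
qed

lemma fixed_by_refl_prod:
  assumes "\<And>t. t \<in> set ts \<Longrightarrow> x \<circ> t = x"
  shows "x \<circ> refl_prod ts = x"
  using assms
proof (induction ts)
  case (Cons t ts)
  have "x \<circ> refl_prod (t # ts) = (x \<circ> t) \<circ> refl_prod ts"
    by (simp only: refl_prod_simps o_assoc)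
  then show ?case using Cons by (simp only: list.set_intros)
qed (simp only: refl_prod_simps comp_id)

lemma vector_comp_negate4:
  fixes x :: "int \<Rightarrow> 'a::ring"
  assumes "\<And>i. x (- i) = - x i" "\<And>i. \<bar>i\<bar> > 4 \<Longrightarrow> x i = 0"
  shows "(x \<circ> negate4) i = - x i"
  using assms by (simp add: negate4_def)

text \<open>Three or fewer reflections fix a common nonzero vector that \<open>negate4\<close>
  negates, which is impossible over the rationals.\<close>

lemma length_factorization_negate4:
  assumes "set ts \<subseteq> D_reflections n" "refl_prod ts = negate4"
  shows "4 \<le> length ts"
proof (rule ccontr)
  assume "\<not> 4 \<le> length ts"
  then have "length ts \<le> 3" by simp
  then obtain x :: "int \<Rightarrow> rat" where x: "\<And>i. x (- i) = - x i" "\<And>t. t \<in> set ts \<Longrightarrow> x \<circ> t = x"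
    "\<And>i. \<bar>i\<bar> > 4 \<Longrightarrow> x i = 0" "\<exists>i. x i \<noteq> 0"
    using ex_fixed_vector[OF assms(1)] by metis
  have "x i = - x i" for i
    using fixed_by_refl_prod[of ts x] x(2) vector_comp_negate4[of x, OF x(1,3), of i] assms(2) by simp
  then show False using x(4) by simp
qed

section \<open>Supports of reflections and commutation\<close>

text \<open>For a reflection this is the support of its root. Positive indices suffice because the
  maps are odd.\<close>

definition moved_indices :: "(int \<Rightarrow> int) \<Rightarrow> int set" where
  "moved_indices t = {i. 0 < i \<and> t i \<noteq> i}"

lemma moved_indices_paired_cycle:
  assumes "a \<noteq> 0" "b \<noteq> 0" "\<bar>a\<bar> \<noteq> \<bar>b\<bar>"
  shows "moved_indices (paired_cycle [a, b]) = {\<bar>a\<bar>, \<bar>b\<bar>}"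
proof -
  have "a \<noteq> b" "a \<noteq> - b" using assms(3) by auto
  then have "paired_cycle [a, b] i \<noteq> i \<longleftrightarrow> i = a \<or> i = b \<or> i = - a \<or> i = - b" for i
    using assms(1,2) unfolding paired_cycle_apply[OF assms] by presburger
  then have "i \<in> moved_indices (paired_cycle [a, b]) \<longleftrightarrow>
      0 < i \<and> (i = a \<or> i = b \<or> i = - a \<or> i = - b)" for i
    unfolding moved_indices_def by blast
  moreover have "0 < i \<and> (i = a \<or> i = b \<or> i = - a \<or> i = - b) \<longleftrightarrow> i = \<bar>a\<bar> \<or> i = \<bar>b\<bar>" for i
    using assms(1,2) by linarith
  ultimately show ?thesis by blast
qed

lemma paired_cycle_conjugate:
  assumes "inj w" "\<And>i. w (- i) = - w i"
  shows "w \<circ> paired_cycle [a, b] = paired_cycle [w a, w b] \<circ> w"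
proof -
  have "w (transpose c d i) = transpose (w c) (w d) (w i)" for c d i
    using assms(1) by (auto simp: transpose_def inj_eq)
  then show ?thesis
    using assms(2) by (auto simp: paired_cycle_def)
qed

text \<open>The support determines the entries up to order and signs; the eight possibilities give
  only two reflections.\<close>

lemma reflection_on_moved:
  assumes t: "t \<in> D_reflections n" and ab: "a \<noteq> 0" "b \<noteq> 0" "\<bar>a\<bar> \<noteq> \<bar>b\<bar>"
    and moved: "moved_indices t = {\<bar>a\<bar>, \<bar>b\<bar>}"
  shows "t a = b \<and> t b = a \<or> t a = - b \<and> t b = - a"
proof -
  obtain c d where cd: "c \<noteq> 0" "d \<noteq> 0" "\<bar>c\<bar> \<noteq> \<bar>d\<bar>" "t = paired_cycle [c, d]"
    using t by (rule D_reflectionsE)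
  then have "{\<bar>c\<bar>, \<bar>d\<bar>} = {\<bar>a\<bar>, \<bar>b\<bar>}"
    using moved by (simp add: moved_indices_paired_cycle)
  then consider "c = a" "d = b" | "c = a" "d = - b" | "c = - a" "d = b" | "c = - a" "d = - b"
    | "c = b" "d = a" | "c = b" "d = - a" | "c = - b" "d = a" | "c = - b" "d = - a"
    by (auto simp: doubleton_eq_iff abs_eq_iff)
  then show ?thesis
    using ab unfolding cd(4) by cases (simp add: paired_cycle_apply; auto)+
qed

text \<open>Conjugation by \<open>s\<close> replaces the entries \<open>a, b\<close> of
  \<open>t\<close> by \<open>s a, s b\<close>. Under the hypothesis these are \<open>a, b\<close> or
  \<open>b, a\<close> or \<open>- b, - a\<close>, which all describe \<open>t\<close>.\<close>

lemma reflections_commute: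
  assumes s: "s \<in> D_reflections n" and t: "t \<in> D_reflections n"
    and moved: "moved_indices s = moved_indices t \<or> moved_indices s \<inter> moved_indices t = {}"
  shows "s \<circ> t = t \<circ> s"
proof -
  obtain a b where ab: "a \<noteq> 0" "b \<noteq> 0" "\<bar>a\<bar> \<noteq> \<bar>b\<bar>" "t = paired_cycle [a, b]"
    using t by (rule D_reflectionsE)
  then have moved_t: "moved_indices t = {\<bar>a\<bar>, \<bar>b\<bar>}"
    by (simp add: moved_indices_paired_cycle)
  have odd: "s (- i) = - s i" for i
    using reflection_in_B_group[OF s] by (simp add: B_group_def)
  have "inj s"
    using reflection_involution[OF s] by (metis inj_on_id inj_on_imageI2)
  then have "s \<circ> t = paired_cycle [s a, s b] \<circ> s"
    unfolding ab(4) using odd by (rule paired_cycle_conjugate)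
  moreover have "(s a, s b) \<in> {(a, b), (b, a), (- b, - a)}"
  proof (cases "moved_indices s = moved_indices t")
    case True
    then show ?thesis using reflection_on_moved[OF s ab(1-3)] moved_t by auto
  next
    case False
    then have "\<bar>a\<bar> \<notin> moved_indices s" "\<bar>b\<bar> \<notin> moved_indices s" using moved moved_t by auto
    then have "s \<bar>a\<bar> = \<bar>a\<bar>" "s \<bar>b\<bar> = \<bar>b\<bar>" using ab by (auto simp: moved_indices_def)
    then have "s a = a" "s b = b" using odd[of a] odd[of b] by (auto simp: abs_if split: if_splits)
    then show ?thesis by simp
  qed
  moreover have "paired_cycle [b, a] = t" "paired_cycle [- b, - a] = t"
    using ab(1-3) unfolding ab(4) by (auto simp: fun_eq_iff paired_cycle_apply)
  ultimately show ?thesis using ab(4) by auto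
qed

text \<open>A vector in the \<open>-1\<close>-eigenspace fixed by the first three of four factors is negated by the
  last one, hence a multiple of its root. So this root has its support in \<open>{1..4}\<close> and is orthogonal
  to the other roots.\<close>

lemma last_factor_of_negate4:
  assumes "set (ts @ [t]) \<subseteq> D_reflections n" "length ts = 3" "refl_prod (ts @ [t]) = negate4"
  shows "moved_indices t \<subseteq> {1..4}"
    and "s \<in> set ts \<Longrightarrow> moved_indices s = moved_indices t \<or> moved_indices s \<inter> moved_indices t = {}"
    and "refl_prod (t # ts) = negate4"
proof -
  have ts: "set ts \<subseteq> D_reflections n" and t: "t \<in> D_reflections n" using assms(1) by auto
  obtain x :: "int \<Rightarrow> rat" where odd: "\<And>i. x (- i) = - x i"
    and fixd: "\<And>t. t \<in> set ts \<Longrightarrow> x \<circ> t = x"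
    and x: "\<And>i. \<bar>i\<bar> > 4 \<Longrightarrow> x i = 0" "\<exists>i. x i \<noteq> 0"
    using ex_fixed_vector[OF ts] assms(2) by (metis order_refl)
  \<comment> \<open>The first three factors fix \<open>x\<close>, so \<open>t\<close> alone acts on
    it like the whole product.\<close>
  have "x \<circ> t = x \<circ> refl_prod ts \<circ> t"
    using fixed_by_refl_prod[of ts x] fixd by simp
  also have "\<dots> = x \<circ> negate4"
    unfolding assms(3)[symmetric] refl_prod_append by (simp add: o_assoc)
  finally have neg: "x (t i) = - x i" for i
    using vector_comp_negate4[of x, OF odd x(1), of i] by (metis comp_apply)
  obtain a b where ab: "a \<noteq> 0" "b \<noteq> 0" "\<bar>a\<bar> \<noteq> \<bar>b\<bar>" "t = paired_cycle [a, b]"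
    using t by (rule D_reflectionsE)
  note t_apply = paired_cycle_apply[OF ab(1-3), folded ab(4)]
  have outside: "x i = 0" if "\<bar>i\<bar> \<noteq> \<bar>a\<bar>" "\<bar>i\<bar> \<noteq> \<bar>b\<bar>" for i
  proof -
    have "t i = i" using that by (auto simp: t_apply)
    then show ?thesis using neg[of i] by simp
  qed
  have "x b = - x a" using neg[of a] by (simp add: t_apply)
  have xa: "x a \<noteq> 0"
  proof
    assume "x a = 0"
    then have "x i = 0" for i
      using outside[of i] odd[of i] odd[of a] odd[of b] \<open>x b = - x a\<close> by (auto simp: abs_eq_iff)
    then show False using x(2) by simp
  qed
  have moved: "moved_indices t = {\<bar>a\<bar>, \<bar>b\<bar>}"
    using ab moved_indices_paired_cycle by simp
  have "\<bar>a\<bar> \<le> 4" "\<bar>b\<bar> \<le> 4"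
    using x(1)[of a] x(1)[of b] xa \<open>x b = - x a\<close> by fastforce+
  then show "moved_indices t \<subseteq> {1..4}" using ab moved by auto
  have step: "(moved_indices s = moved_indices t \<or> moved_indices s \<inter> moved_indices t = {}) \<and>
    s \<circ> t = t \<circ> s" if "s \<in> set ts" for s
  proof -
    have "s \<in> D_reflections n" using that ts by auto
    then obtain c d where cd: "c \<noteq> 0" "d \<noteq> 0" "\<bar>c\<bar> \<noteq> \<bar>d\<bar>" "s = paired_cycle [c, d]"
      by (rule D_reflectionsE)
    have "x (s c) = x c" using fixd[OF that] by (metis comp_apply)
    then have "x d = x c" using cd by (simp add: paired_cycle_apply)
    have inside: "x i \<noteq> 0" if "\<bar>i\<bar> = \<bar>a\<bar> \<or> \<bar>i\<bar> = \<bar>b\<bar>" for i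
      using that xa \<open>x b = - x a\<close> odd[of a] odd[of b] by (auto simp: abs_eq_iff)
    \<comment> \<open>The vector \<open>x\<close> is nonzero exactly at the indices with absolute
      value \<open>\<bar>a\<bar>\<close> or \<open>\<bar>b\<bar>\<close>, and it agrees at
      \<open>c\<close> and \<open>d\<close>. So both of these or neither belong to the support of
      the root of \<open>t\<close>.\<close>
    have disj: "{\<bar>c\<bar>, \<bar>d\<bar>} = {\<bar>a\<bar>, \<bar>b\<bar>} \<or> {\<bar>c\<bar>, \<bar>d\<bar>} \<inter> {\<bar>a\<bar>, \<bar>b\<bar>} = {}"
    proof (cases "x c = 0")
      case True
      then have "\<bar>c\<bar> \<notin> {\<bar>a\<bar>, \<bar>b\<bar>}" "\<bar>d\<bar> \<notin> {\<bar>a\<bar>, \<bar>b\<bar>}"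
        using inside[of c] inside[of d] \<open>x d = x c\<close> by auto
      then show ?thesis by blast
    next
      case False
      then have "\<bar>c\<bar> \<in> {\<bar>a\<bar>, \<bar>b\<bar>}" "\<bar>d\<bar> \<in> {\<bar>a\<bar>, \<bar>b\<bar>}"
        using outside[of c] outside[of d] \<open>x d = x c\<close> by auto
      then have "{\<bar>c\<bar>, \<bar>d\<bar>} = {\<bar>a\<bar>, \<bar>b\<bar>}"
        using cd(3) by (metis insertE insert_commute singletonD)
      then show ?thesis ..
    qed
    show ?thesis
      using disj reflections_commute[of s n t] \<open>s \<in> D_reflections n\<close> t cd moved
        moved_indices_paired_cycle by simp
  qed
  then show "moved_indices s = moved_indices t \<or> moved_indices s \<inter> moved_indices t = {}"
    if "s \<in> set ts" using that by blast
  \<comment> \<open>Commuting with every factor, \<open>t\<close> can be moved to the front, which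
    rotates the factorization.\<close>
  have "t \<circ> refl_prod ss = refl_prod ss \<circ> t" if "set ss \<subseteq> set ts" for ss
    using that
  proof (induction ss)
    case (Cons s ss)
    then have "t (s i) = s (t i)" for i using step by (metis comp_apply list.set_intros(1) subsetD)
    moreover have "t (refl_prod ss i) = refl_prod ss (t i)" for i
      using Cons by (metis comp_apply list.set_intros(2) subset_iff)
    ultimately show ?case by (simp add: fun_eq_iff)
  qed simp
  then show "refl_prod (t # ts) = negate4"
    using assms(3) by (simp add: refl_prod_append)
qed

text \<open>Rotating the word makes each factor the last one in turn, so what holds for the last
  factor holds for all.\<close>

lemma factors_of_negate4:
  assumes "set ts \<subseteq> D_reflections n" "length ts = 4" "refl_prod ts = negate4"
  shows "\<And>t. t \<in> set ts \<Longrightarrow> moved_indices t \<subseteq> {1..4}"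
    and "\<And>s t. s \<in> set ts \<Longrightarrow> t \<in> set ts \<Longrightarrow>
      moved_indices s = moved_indices t \<or> moved_indices s \<inter> moved_indices t = {}"
proof -
  obtain a b c d where ts: "ts = [a, b, c, d]"
    using assms(2) by (auto simp: numeral_eq_Suc length_Suc_conv)
  have R: "a \<in> D_reflections n" "b \<in> D_reflections n" "c \<in> D_reflections n" "d \<in> D_reflections n"
    using assms(1) ts by auto
  have d: "refl_prod ([a, b, c] @ [d]) = negate4" using assms(3) ts by simp
  note D = last_factor_of_negate4[OF _ _ d, of n]
  have c: "refl_prod ([d, a, b] @ [c]) = negate4" using D(3) R by simp
  note C = last_factor_of_negate4[OF _ _ c, of n]
  have b: "refl_prod ([c, d, a] @ [b]) = negate4" using C(3) R by simp
  note B = last_factor_of_negate4[OF _ _ b, of n]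
  have a: "refl_prod ([b, c, d] @ [a]) = negate4" using B(3) R by simp
  note A = last_factor_of_negate4[OF _ _ a, of n]
  show "moved_indices t \<subseteq> {1..4}" if "t \<in> set ts" for t
    using that A(1) B(1) C(1) D(1) R unfolding ts by auto
  show "moved_indices s = moved_indices t \<or> moved_indices s \<inter> moved_indices t = {}"
    if "s \<in> set ts" "t \<in> set ts" for s t
    using that A(2)[of s] B(2)[of s] C(2)[of s] D(2)[of s] R unfolding ts by auto
qed

section \<open>The open interval below the negation on four coordinates\<close>

text \<open>On the pair, \<open>t\<close> is the identity, the exchange, or the exchange with both
  signs changed. The product of two values of an odd function survives each of these.\<close>

lemma reflection_swap_value:
  assumes "t \<in> D_reflections n" "0 < a" "0 < b" "a \<noteq> b"
    and "moved_indices t = {a, b} \<or> moved_indices t \<inter> {a, b} = {}"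
    and odd: "\<And>i. w (- i) = - w i"
  shows "w (t a) * w (t b) = w a * (w b :: int)"
  using assms(5)
proof
  assume "moved_indices t \<inter> {a, b} = {}"
  then show ?thesis using assms(2,3) by (auto simp: moved_indices_def)
next
  assume moved: "moved_indices t = {a, b}"
  then have "t a = b \<and> t b = a \<or> t a = - b \<and> t b = - a"
    using reflection_on_moved[OF assms(1), of a b] assms(2-4) by simp
  then show ?thesis by (auto simp: odd)
qed

lemma refl_prod_pair_value:
  assumes "set ts \<subseteq> D_reflections n" "0 < a" "0 < b" "a \<noteq> b"
    and "\<And>t. t \<in> set ts \<Longrightarrow> moved_indices t = {a, b} \<or> moved_indices t \<inter> {a, b} = {}"
  shows "refl_prod ts a * refl_prod ts b = a * b"
  using assms(1,5)
\<comment> \<open>The last factor of the word acts first on the arguments \<open>a\<close> and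
  \<open>b\<close>, hence the induction from that end.\<close>
proof (induction ts rule: rev_induct)
  case (snoc t ts)
  have "refl_prod ts (- i) = - refl_prod ts i" for i
    using snoc.prems by (intro D_group_odd[of _ n] refl_prod_in_D_group) auto
  then have "refl_prod ts (t a) * refl_prod ts (t b) = refl_prod ts a * refl_prod ts b"
    using snoc.prems assms(2-4) by (intro reflection_swap_value[of t n]) auto
  then show ?case using snoc by (simp add: refl_prod_append)
qed simp

text \<open>A numerical trace of preserving both pairs up to sign, with an even number of sign
  changes in each. It is weaker than that property, but suffices to tell the partitions
  apart.\<close>

definition preserves_pairs :: "int \<Rightarrow> int \<Rightarrow> int \<Rightarrow> int \<Rightarrow> (int \<Rightarrow> int) \<Rightarrow> bool" where
  "preserves_pairs a b c d w \<longleftrightarrow> w a * w b = a * b \<and> w c * w d = c * d"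

lemma factors_of_negate4_preserve_pairs:
  assumes "set ts \<subseteq> D_reflections n" "length ts = 4" "refl_prod ts = negate4"
  obtains a b c d where "(a, b, c, d) \<in> {(1, 2, 3, 4), (1, 3, 2, 4), (1, 4, 2, 3)}"
    "\<forall>ss. set ss \<subseteq> set ts \<longrightarrow> preserves_pairs a b c d (refl_prod ss)"
proof -
  note supp = factors_of_negate4[OF assms]
  have pair: "\<exists>p q. 0 < p \<and> p < q \<and> moved_indices t = {p, q}" if "t \<in> set ts" for t
  proof -
    have "t \<in> D_reflections n" using assms(1) that by auto
    then obtain p q where pq: "p \<noteq> 0" "q \<noteq> 0" "\<bar>p\<bar> \<noteq> \<bar>q\<bar>" "t = paired_cycle [p, q]"
      by (rule D_reflectionsE)
    then show ?thesis
      using moved_indices_paired_cycle[of p q] linorder_neqE[of "\<bar>p\<bar>" "\<bar>q\<bar>"]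
      by (metis insert_commute zero_less_abs_iff)
  qed
  obtain t0 where t0: "t0 \<in> set ts" using assms(2) by (cases ts) auto
  obtain p q where pq: "0 < p" "p < q" "moved_indices t0 = {p, q}"
    using pair[OF t0] by blast
  have "{p, q} \<subseteq> {1..4}" using supp(1)[OF t0] pq by simp
  then have "p \<in> {1, 2, 3, 4}" "q \<in> {1, 2, 3, 4}" by auto
  \<comment> \<open>\<open>{r, s}\<close> is the complement of the support of \<open>t0\<close>. The
    partitions are listed with the pair containing 1 first, and this may be either of the two
    pairs.\<close>
  then obtain r s where rs: "0 < r" "r < s" "{p, q} \<inter> {r, s} = {}" "{p, q} \<union> {r, s} = {1..4}"
    and cases: "(p, q, r, s) \<in> {(1, 2, 3, 4), (1, 3, 2, 4), (1, 4, 2, 3)} \<or>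
      (r, s, p, q) \<in> {(1, 2, 3, 4), (1, 3, 2, 4), (1, 4, 2, 3)}"
  proof -
    have set4: "{1..4::int} = {1, 2, 3, 4}" by auto
    consider "p = 1" "q = 2" | "p = 1" "q = 3" | "p = 1" "q = 4" | "p = 2" "q = 3" | "p = 2" "q = 4"
      | "p = 3" "q = 4"
      using \<open>p \<in> _\<close> \<open>q \<in> _\<close> pq(2) by auto
    then show ?thesis
    proof cases
      case 1
      then show ?thesis by (intro that[of 3 4]) (auto simp: set4)
    next
      case 2
      then show ?thesis by (intro that[of 2 4]) (auto simp: set4)
    next
      case 3
      then show ?thesis by (intro that[of 2 3]) (auto simp: set4)
    next
      case 4
      then show ?thesis by (intro that[of 1 4]) (auto simp: set4)
    next
      case 5
      then show ?thesis by (intro that[of 1 3]) (auto simp: set4)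
    next
      case 6
      then show ?thesis by (intro that[of 1 2]) (auto simp: set4)
    qed
  qed
  \<comment> \<open>A support other than \<open>{r, s}\<close> meets \<open>{p, q}\<close>, and
    supports of factors that meet coincide.\<close>
  have "moved_indices t = {p, q} \<or> moved_indices t = {r, s}" if "t \<in> set ts" for t
  proof -
    obtain x y where xy: "x < y" "moved_indices t = {x, y}" using pair[OF \<open>t \<in> set ts\<close>] by blast
    show ?thesis
    proof (rule disjCI)
      assume "moved_indices t \<noteq> {r, s}"
      then have "\<not> {x, y} \<subseteq> {r, s}" using xy by auto
      moreover have "{x, y} \<subseteq> {p, q} \<union> {r, s}" using supp(1)[OF that] xy(2) rs(4) by simp
      ultimately have "{x, y} \<inter> {p, q} \<noteq> {}" by blast
      then show "moved_indices t = {p, q}" using supp(2)[OF that t0] unfolding xy(2) pq(3) by meson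
    qed
  qed
  then have all: "moved_indices t = {p, q} \<or> moved_indices t = {r, s}"
    if "set ss \<subseteq> set ts" "t \<in> set ss" for t ss
    using that by blast
  have pq_rs: "preserves_pairs p q r s (refl_prod ss)" if "set ss \<subseteq> set ts" for ss
    unfolding preserves_pairs_def
  proof
    have ss: "set ss \<subseteq> D_reflections n" using that assms(1) by blast
    have "moved_indices t = {p, q} \<or> moved_indices t \<inter> {p, q} = {}"
      and "moved_indices t = {r, s} \<or> moved_indices t \<inter> {r, s} = {}" if "t \<in> set ss" for t
      using all[OF \<open>set ss \<subseteq> set ts\<close> that] rs(3) by (metis Int_commute)+
    then show "refl_prod ss p * refl_prod ss q = p * q" "refl_prod ss r * refl_prod ss s = r * s"
      using pq(1,2) rs(1,2) by (intro refl_prod_pair_value[OF ss]; simp)+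
  qed
  have rs_pq: "preserves_pairs r s p q (refl_prod ss)" if "set ss \<subseteq> set ts" for ss
    using pq_rs[OF that] by (simp add: preserves_pairs_def)
  from cases show ?thesis
  proof
    assume "(p, q, r, s) \<in> {(1, 2, 3, 4), (1, 3, 2, 4), (1, 4, 2, 3)}"
    then show ?thesis by (rule that) (use pq_rs in blast)
  next
    assume "(r, s, p, q) \<in> {(1, 2, 3, 4), (1, 3, 2, 4), (1, 4, 2, 3)}"
    then show ?thesis by (rule that) (use rs_pq in blast)
  qed
qed

text \<open>Injectivity excludes the values \<open>(2, 1, 6, 2)\<close> at \<open>(1, 2, 3, 4)\<close>.\<close>

lemma preserves_two_pairings:
  assumes "inj w" and odd: "\<And>i. w (- i) = - w i" and fixes_rest: "\<And>i. \<bar>i\<bar> > 4 \<Longrightarrow> w i = i"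
    and "preserves_pairs 1 2 3 4 w" "preserves_pairs 1 3 2 4 w \<or> preserves_pairs 1 4 2 3 w"
  shows "w = id \<or> w = negate4"
proof -
  have eqs: "w 1 * w 2 = 2" "w 3 * w 4 = 12"
    "w 1 * w 3 = 3 \<and> w 2 * w 4 = 8 \<or> w 1 * w 4 = 4 \<and> w 2 * w 3 = 6"
    using assms(4,5) by (auto simp: preserves_pairs_def)
  have "w 4 \<noteq> w 1" using \<open>inj w\<close> by (simp add: inj_eq)
  \<comment> \<open>Divisibility leaves four values for \<open>w 1\<close>; the values 1 and -1
    determine the rest by the product equations.\<close>
  have "w 1 dvd 2" using eqs(1) by (metis dvd_triv_left)
  then have "\<bar>w 1\<bar> \<le> 2" "w 1 \<noteq> 0" using dvd_imp_le_int[of 2 "w 1"] by auto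
  then consider "w 1 = 1" | "w 1 = - 1" | "w 1 = 2" | "w 1 = - 2" by linarith
  then obtain e where e: "e = 1 \<or> e = - 1" "w 1 = e" "w 2 = 2 * e" "w 3 = 3 * e" "w 4 = 4 * e"
  proof cases
    case 1
    then have "w 2 = 2" using eqs(1) by simp
    then show ?thesis using 1 eqs by (intro that[of 1]) auto
  next
    case 2
    then have "w 2 = - 2" using eqs(1) by simp
    then show ?thesis using 2 eqs by (intro that[of "- 1"]) auto
  next
    case 3
    \<comment> \<open>The first alternative fails by parity; the second gives
      \<open>w 4 = 2 = w 1\<close>, against injectivity.\<close>
    have "w 1 * w 3 = 3 \<or> w 1 * w 4 = 4" using eqs(3) by blast
    then have False using \<open>w 4 \<noteq> w 1\<close> unfolding 3 by presburger
    then show ?thesis ..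
  next
    case 4
    have "w 1 * w 3 = 3 \<or> w 1 * w 4 = 4" using eqs(3) by blast
    then have False using \<open>w 4 \<noteq> w 1\<close> unfolding 4 by presburger
    then show ?thesis ..
  qed
  have "w i = e * i" if "\<bar>i\<bar> \<le> 4" for i
  proof -
    have "i \<in> {-4, -3, -2, -1, 0, 1, 2, 3, 4}" using that by auto
    then show ?thesis using e odd[of 0] odd[of 1] odd[of 2] odd[of 3] odd[of 4] by auto
  qed
  then have "w i = (if e = 1 then id i else negate4 i)" for i
    using fixes_rest[of i] e(1) by (cases "\<bar>i\<bar> \<le> 4") (auto simp: negate4_def)
  then show ?thesis using e(1) by (auto simp: fun_eq_iff)
qed

text \<open>A shortest word of \<open>x\<close> extends to one of \<open>y\<close> and then to one
  of \<open>negate4\<close>. Thus \<open>x\<close> and \<open>y\<close> are products of prefixes of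
  a single factorization and preserve its partition; being neither \<open>id\<close> nor
  \<open>negate4\<close>, they share their answer for the first partition.\<close>

lemma comparable_below_negate4:
  assumes "abs_le n x y" "abs_le n y negate4" "abs_length n negate4 = 4"
    and carrier: "x \<in> carrier (D_group n)" "y \<in> carrier (D_group n)" "negate4 \<in> carrier (D_group n)"
    and nontrivial: "x \<notin> {id, negate4}" "y \<notin> {id, negate4}"
  shows "preserves_pairs 1 2 3 4 x \<longleftrightarrow> preserves_pairs 1 2 3 4 y"
proof -
  obtain ps where ps: "set ps \<subseteq> D_reflections n" "x = refl_prod ps" "length ps = abs_length n x"
    using carrier(1) by (rule reduced_wordE)
  obtain qs where qs: "set qs \<subseteq> D_reflections n" "y = refl_prod (ps @ qs)"
    "length (ps @ qs) = abs_length n y"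
    using abs_leE[OF assms(1) carrier(1,2) ps] .
  have psqs: "set (ps @ qs) \<subseteq> D_reflections n" using ps qs by simp
  obtain rs where rs: "set rs \<subseteq> D_reflections n" "negate4 = refl_prod ((ps @ qs) @ rs)"
    "length ((ps @ qs) @ rs) = abs_length n negate4"
    using abs_leE[OF assms(2) carrier(2,3) psqs qs(2,3)] .
  define ts where "ts = (ps @ qs) @ rs"
  have ts: "set ts \<subseteq> D_reflections n" "length ts = 4" "refl_prod ts = negate4"
    using psqs rs assms(3) by (auto simp: ts_def)
  obtain a b c d where abcd: "(a, b, c, d) \<in> {(1, 2, 3, 4), (1, 3, 2, 4), (1, 4, 2, 3)}"
    "\<forall>ss. set ss \<subseteq> set ts \<longrightarrow> preserves_pairs a b c d (refl_prod ss)"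
    using factors_of_negate4_preserve_pairs[OF ts] .
  \<comment> \<open>For n above 4 this confines the elements to the first four coordinates: no
    factor moves a larger index.\<close>
  have fixes_rest: "refl_prod ss i = i" if "set ss \<subseteq> set ts" "\<bar>i\<bar> > 4" for ss i
    using that(1)
  proof (induction ss)
    case (Cons t ss)
    then have "moved_indices t \<subseteq> {1..4}" "t \<in> D_reflections n"
      using factors_of_negate4(1)[OF ts] ts(1) by auto
    moreover have "t (- i) = - t i"
      using reflection_in_B_group[OF \<open>t \<in> D_reflections n\<close>] by (simp add: B_group_def)
    moreover have "t \<bar>i\<bar> = \<bar>i\<bar>"
    proof -
      have "\<bar>i\<bar> \<notin> moved_indices t" using \<open>moved_indices t \<subseteq> {1..4}\<close> that(2) by auto
      then show ?thesis using that(2) by (auto simp: moved_indices_def)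
    qed
    ultimately have "t i = i" by (cases "0 < i") auto
    then show ?case using Cons by simp
  qed simp
  \<comment> \<open>The answer depends on the factorization alone, since preserving a second
    partition along with the first would make \<open>w\<close> equal to \<open>id\<close> or
    \<open>negate4\<close>.\<close>
  have iff: "preserves_pairs 1 2 3 4 w \<longleftrightarrow> (a, b, c, d) = (1, 2, 3, 4)"
    if w: "w = refl_prod ss" "set ss \<subseteq> set ts" "w \<notin> {id, negate4}" for w ss
  proof -
    have D: "w \<in> carrier (D_group n)"
      unfolding w(1) using w(2) ts(1) by (intro refl_prod_in_D_group) blast
    then have "inj w"
      using D_group_subset_B_group[of n] by (auto simp: B_group_def intro: permutes_inj)
    then have "\<not> (preserves_pairs 1 2 3 4 w \<and>
        (preserves_pairs 1 3 2 4 w \<or> preserves_pairs 1 4 2 3 w))"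
      using preserves_two_pairings[of w] D_group_odd[OF D] fixes_rest[OF w(2)] w(1,3) by blast
    moreover have "preserves_pairs a b c d w" using abcd(2) w(1,2) by blast
    moreover consider "(a, b, c, d) = (1, 2, 3, 4)" | "(a, b, c, d) = (1, 3, 2, 4)"
      | "(a, b, c, d) = (1, 4, 2, 3)" using abcd(1) by blast
    ultimately show ?thesis by cases (simp_all, blast+)
  qed
  have sub: "set ps \<subseteq> set ts" "set (ps @ qs) \<subseteq> set ts" by (auto simp: ts_def)
  show ?thesis
    using iff[OF ps(2) sub(1) nontrivial(1)] iff[OF qs(2) sub(2) nontrivial(2)] by simp
qed

text \<open>The two reflections supported on a pair have as product the negation of both its
  indices.\<close>

lemma negate4_word:
  assumes "(a, b, c, d) \<in> {(1, 2, 3, 4), (1, 3, 2, 4)}"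
  shows "refl_prod [paired_cycle [a, b], paired_cycle [a, - b], paired_cycle [c, d],
    paired_cycle [c, - d]] = negate4" (is "?w = _")
proof
  fix i :: int
  have "\<bar>i\<bar> \<le> 4 \<longleftrightarrow> i \<in> {-4, -3, -2, -1, 0, 1, 2, 3, 4}" by auto
  then show "?w i = negate4 i"
    using assms by (auto simp: negate4_def paired_cycle_apply)
qed

section \<open>The interval from the identity to \<open>negate4\<close> for n at least 4\<close>

context
  fixes n :: nat
  assumes n: "4 \<le> n"
begin

lemma small_reflections:
  "{paired_cycle [1, 2], paired_cycle [1, - 2], paired_cycle [1, 3], paired_cycle [1, - 3],
    paired_cycle [2, 4], paired_cycle [2, - 4], paired_cycle [3, 4], paired_cycle [3, - 4]}
    \<subseteq> D_reflections n"
proof -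
  have "paired_cycle [i, j] \<in> D_reflections n" "paired_cycle [i, - j] \<in> D_reflections n"
    if "1 \<le> i" "i < j" "j \<le> 4" for i j
    using that n by (fastforce simp: D_reflections_def)+
  then show ?thesis by simp
qed

lemma negate4_in_D_group: "negate4 \<in> carrier (D_group n)"
  using refl_prod_in_D_group[of _ n] negate4_word[of 1 2 3 4] small_reflections
  by (metis (no_types, lifting) empty_subsetI insertCI insert_subset list.set(1,2))

lemma abs_length_negate4: "abs_length n negate4 = 4"
proof (rule antisym)
  show "abs_length n negate4 \<le> 4"
    using abs_length_le[of "[paired_cycle [1, 2], paired_cycle [1, - 2], paired_cycle [3, 4],
      paired_cycle [3, - 4]]" n] small_reflections negate4_word[of 1 2 3 4] by simp
  show "4 \<le> abs_length n negate4"
    using negate4_in_D_group by (rule reduced_wordE) (metis length_factorization_negate4)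
qed

lemma prefix_of_negate4_word:
  assumes "refl_prod (ss @ ts) = negate4" "set (ss @ ts) \<subseteq> D_reflections n" "length (ss @ ts) = 4"
  shows "abs_le n (refl_prod ss) negate4" "refl_prod ss \<in> carrier (D_group n)"
    and "abs_length n (refl_prod ss) = length ss"
  using abs_le_refl_prod[of ss ts n] abs_length_prefix[of ss ts n] assms abs_length_negate4
  by (auto intro!: refl_prod_in_D_group)

text \<open>\<open>s\<close> and \<open>t\<close> witness two different components of the open
  interval, while \<open>s\<close> and \<open>c\<close> form an edge, so that its order complex has
  positive dimension.\<close>

lemma chain_below_negate4:
  defines "s \<equiv> paired_cycle [1, 2]" and "c \<equiv> refl_prod [paired_cycle [1, 2], paired_cycle [1, - 2]]"
    and "t \<equiv> paired_cycle [1, 3]"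
  shows "{s, c, t} \<subseteq> carrier (D_group n)"
    and "abs_le n s c" "abs_le n s negate4" "abs_le n c negate4" "abs_le n t negate4"
    and "distinct [id, negate4, s, c, t]"
    and "preserves_pairs 1 2 3 4 s" "\<not> preserves_pairs 1 2 3 4 t"
proof -
  let ?r = "\<lambda>a b. paired_cycle [a, b]"
  note s = prefix_of_negate4_word[of "[?r 1 2]" "[?r 1 (- 2), ?r 3 4, ?r 3 (- 4)]"]
  note c = prefix_of_negate4_word[of "[?r 1 2, ?r 1 (- 2)]" "[?r 3 4, ?r 3 (- 4)]"]
  note t = prefix_of_negate4_word[of "[?r 1 3]" "[?r 1 (- 3), ?r 2 4, ?r 2 (- 4)]"]
  have word: "refl_prod [?r 1 2, ?r 1 (- 2), ?r 3 4, ?r 3 (- 4)] = negate4"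
    "refl_prod [?r 1 3, ?r 1 (- 3), ?r 2 4, ?r 2 (- 4)] = negate4"
    using negate4_word[of 1 2 3 4] negate4_word[of 1 3 2 4] by simp_all
  show "{s, c, t} \<subseteq> carrier (D_group n)" "abs_le n s negate4" "abs_le n c negate4"
      "abs_le n t negate4"
    using s(1,2) c(1,2) t(1,2) word small_reflections by (simp_all add: s_def c_def t_def)
  show "abs_le n s c"
    using abs_le_refl_prod[of "[?r 1 2]" "[?r 1 (- 2)]" n] c(3) word small_reflections
    by (simp add: s_def c_def)
  \<comment> \<open>The values at 1 and 3 tell the five elements apart; those at 2 and 4 serve the
    pair products.\<close>
  have vals: "id 1 = (1::int)" "negate4 1 = - 1" "s 1 = 2" "c 1 = - 1" "t 1 = 3"
    "negate4 3 = - 3" "c 3 = 3" "s 2 = 1" "s 3 = 3" "s 4 = 4" "t 2 = 2"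
    by (simp_all add: negate4_def s_def c_def t_def paired_cycle_apply)
  show "preserves_pairs 1 2 3 4 s" "\<not> preserves_pairs 1 2 3 4 t"
    using vals by (simp_all add: preserves_pairs_def)
  have "id \<noteq> negate4" "id \<noteq> s" "id \<noteq> c" "id \<noteq> t" "negate4 \<noteq> s" "negate4 \<noteq> c" "negate4 \<noteq> t"
    "s \<noteq> c" "s \<noteq> t" "c \<noteq> t"
    using vals by force+
  then show "distinct [id, negate4, s, c, t]" by simp
qed

lemma disconnected_open_interval:
  "disconnected (hasse_diagram (open_interval (carrier (D_group n)) (abs_le n) id negate4) (abs_le n))"
proof (rule hasse_diagram_disconnected)
  let ?P = "open_interval (carrier (D_group n)) (abs_le n) id negate4"
  show "paired_cycle [1, 2] \<in> ?P" "paired_cycle [1, 3] \<in> ?P"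
    using chain_below_negate4 abs_le_id by (auto simp: open_interval_def closed_interval_def)
  show "paired_cycle [1, 2] \<in> Collect (preserves_pairs 1 2 3 4)"
    "paired_cycle [1, 3] \<notin> Collect (preserves_pairs 1 2 3 4)"
    using chain_below_negate4(7,8) by simp_all
  show "x \<in> Collect (preserves_pairs 1 2 3 4) \<longleftrightarrow> y \<in> Collect (preserves_pairs 1 2 3 4)"
    if "x \<in> ?P" "y \<in> ?P" "abs_le n x y" for x y
    using that comparable_below_negate4[of n x y] abs_length_negate4 negate4_in_D_group
    by (simp add: open_interval_def closed_interval_def)
qed

text \<open>The face \<open>F\<close> consists of \<open>id\<close> and a maximal chain above \<^const>\<open>negate4\<close>; by maximality its
  link has all its vertices strictly between \<open>id\<close> and \<^const>\<open>negate4\<close>.\<close>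

lemma not_cohen_macaulay_above_interval:
  assumes interval: "closed_interval (carrier (D_group n)) (abs_le n) id negate4 \<subseteq> P"
    and P: "P \<subseteq> carrier (D_group n)"
  shows "\<not> cohen_macaulay (k :: 'k::field itself) P (abs_le n)"
proof -
  let ?K = "order_complex P (abs_le n)"
  define Fs where "Fs = {F \<in> ?K. {id, negate4} \<subseteq> F \<and> (\<forall>f\<in>F. f = id \<or> abs_le n negate4 f)}"
  have "finite P" using P finite_D_group by (rule finite_subset)
  then have "finite ?K"
    by (rule finite_subset[rotated, OF finite_Pow_iff[THEN iffD2]]) (auto simp: order_complex_def)
  then have "finite Fs" by (simp add: Fs_def)
  have inP: "x \<in> P" if "x \<in> carrier (D_group n)" "abs_le n x negate4" for x
    using interval abs_le_id that by (auto simp: closed_interval_def)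
  have "id \<in> P" "negate4 \<in> P"
    using inP negate4_in_D_group id_in_D_group abs_le_id abs_le_refl by blast+
  then have "{id, negate4} \<in> Fs"
    using abs_le_id[OF negate4_in_D_group] abs_le_id[OF id_in_D_group] abs_le_refl[OF negate4_in_D_group]
    by (auto simp: Fs_def order_complex_def Complete_Partial_Order.chain_def)
  then obtain F where F: "F \<in> Fs" and max: "\<And>G. G \<in> Fs \<Longrightarrow> F \<subseteq> G \<Longrightarrow> F = G"
    using finite_has_maximal[OF \<open>finite Fs\<close>] by auto
  have above: "f = id \<or> abs_le n negate4 f" and fD: "f \<in> carrier (D_group n)" if "f \<in> F" for f
    using F that P by (auto simp: Fs_def order_complex_def)
  \<comment> \<open>Members of \<open>F\<close> are \<open>id\<close> or lie above
    \<open>negate4\<close>, hence are comparable with everything below \<open>negate4\<close>. So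
    every chain in the open interval is a face of the link.\<close>
  have face: "S \<in> link ?K F"
    if S: "finite S" "S \<subseteq> carrier (D_group n)" "\<And>x. x \<in> S \<Longrightarrow> abs_le n x negate4"
      "Complete_Partial_Order.chain (abs_le n) S" "id \<notin> S" "negate4 \<notin> S" for S
  proof -
    have le: "abs_le n f x \<or> abs_le n x f" if "f \<in> F" "x \<in> S" for f x
      using above[OF that(1)] abs_le_trans[of n x negate4 f] fD[OF that(1)] S(2,3) that(2)
        negate4_in_D_group abs_le_id by blast
    have "Complete_Partial_Order.chain (abs_le n) F"
      using F by (simp add: Fs_def order_complex_def)
    then have "Complete_Partial_Order.chain (abs_le n) (S \<union> F)"
      using S(4) le unfolding Complete_Partial_Order.chain_def by blast
    moreover have "x \<notin> F" if "x \<in> S" for x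
    proof
      assume "x \<in> F"
      then have "abs_le n negate4 x" using above that S(5) by blast
      then show False
        using abs_le_antisym[of n x negate4] S(2,3,6) \<open>x \<in> S\<close> negate4_in_D_group by blast
    qed
    moreover have "S \<subseteq> P" using S(2,3) inP by blast
    ultimately show ?thesis
      using S(1,4) F by (auto simp: link_def order_complex_def Fs_def)
  qed
  have vertex: "abs_le n v negate4 \<and> v \<in> carrier (D_group n) \<and> v \<notin> {id, negate4}"
    if "S \<in> link ?K F" "v \<in> S" for v S
  proof -
    have v: "v \<notin> F" "insert v F \<in> ?K" "v \<in> P"
      using that F by (auto simp: link_def order_complex_def Fs_def Complete_Partial_Order.chain_def)
    \<comment> \<open>A vertex of the link above \<open>negate4\<close> could be added to
      \<open>F\<close>, against maximality.\<close>
    have "\<not> abs_le n negate4 v"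
    proof
      assume "abs_le n negate4 v"
      then have "insert v F \<in> Fs" using v F by (auto simp: Fs_def)
      then show False using max v(1) by blast
    qed
    then have "abs_le n v negate4"
      using v(2) F by (auto simp: Fs_def order_complex_def Complete_Partial_Order.chain_def)
    then show ?thesis using v F P by (auto simp: Fs_def)
  qed
  show ?thesis
    unfolding cohen_macaulay_def
  proof (rule not_cohen_macaulay_complex)
    show "F \<in> ?K" using F by (simp add: Fs_def)
    show "finite (\<Union>?K)"
      using \<open>finite P\<close> by (rule finite_subset[rotated]) (auto simp: order_complex_def)
    note C = chain_below_negate4
    show "{paired_cycle [1, 2]} \<in> link ?K F" "{paired_cycle [1, 3]} \<in> link ?K F"
      using C(1,3,5,6) abs_le_refl by (auto intro!: face simp: Complete_Partial_Order.chain_def)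
    show "{paired_cycle [1, 2], refl_prod [paired_cycle [1, 2], paired_cycle [1, - 2]]} \<in> link ?K F"
      using C(1-6) abs_le_refl by (intro face) (auto simp: Complete_Partial_Order.chain_def)
    show "paired_cycle [1, 2] \<in> Collect (preserves_pairs 1 2 3 4)"
      "paired_cycle [1, 3] \<notin> Collect (preserves_pairs 1 2 3 4)"
      using C(7,8) by simp_all
    show "paired_cycle [1, 2] \<noteq> refl_prod [paired_cycle [1, 2], paired_cycle [1, - 2]]"
      using C(6) by auto
    show "v \<in> Collect (preserves_pairs 1 2 3 4) \<longleftrightarrow> w \<in> Collect (preserves_pairs 1 2 3 4)"
      if vw: "{v, w} \<in> link ?K F" for v w
    proof -
      have "abs_le n v w \<or> abs_le n w v"
        using vw by (auto simp: link_def order_complex_def Complete_Partial_Order.chain_def)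
      then show ?thesis
        using vertex[OF vw, of v] vertex[OF vw, of w] comparable_below_negate4[of n v w]
          comparable_below_negate4[of n w v] abs_length_negate4 negate4_in_D_group
        by auto
    qed
  qed
qed

end

theorem mainTheorem4:
  fixes u :: "int \<Rightarrow> int" and I :: "(int \<Rightarrow> int) set"
  assumes "u = balanced_cycle [1] \<circ> balanced_cycle [2] \<circ> balanced_cycle [3] \<circ> balanced_cycle [4]"
    and "I = closed_interval (carrier (D_group 4)) (abs_le 4) id u"
  shows "disconnected (hasse_diagram (open_interval (carrier (D_group 4)) (abs_le 4) id u) (abs_le 4)) \<and>
    \<not> cohen_macaulay TYPE('k::field) I (abs_le 4) \<and>
    (\<forall>n\<ge>4. \<not> cohen_macaulay TYPE('k) (carrier (D_group n)) (abs_le n))"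
proof -
  have u: "u = negate4" using assms(1) negate4_eq_balanced_cycles by simp
  have "I \<subseteq> carrier (D_group 4)" by (auto simp: assms(2) closed_interval_def)
  \<comment> \<open>The interval is the smallest admissible \<open>P\<close>, the whole group the
    largest.\<close>
  then have "\<not> cohen_macaulay TYPE('k) I (abs_le 4)"
    using not_cohen_macaulay_above_interval[of 4 I] by (simp add: assms(2) u)
  moreover have "\<not> cohen_macaulay TYPE('k) (carrier (D_group n)) (abs_le n)" if "n \<ge> 4" for n
    using not_cohen_macaulay_above_interval[OF that, of "carrier (D_group n)"]
    by (auto simp: closed_interval_def)
  ultimately show ?thesis
    using disconnected_open_interval[of 4] by (simp add: u)
qed

end
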